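(* Let $M$ be a real Hilbert space, let $G$ be a group acting on $M$, and let $H\subset G$ be a subgroup acting isometrically on $M$. Let $t_0\in M$, $t_0\neq 0$, be a template which is not a fixed point under $G$ and whose orbit under $G$ is bounded. Let $A\ge\sup_{g\in G}\frac{\|g\cdot t_0\|}{\|t_0\|}$ and $0\le a\le\inf_{g\in G}\frac{\|g\cdot t_0\|}{\|t_0\|}$ (so $a\le 1\le A$ and $a\|t_0\|\le\|g\cdot t_0\|\le A\|t_0\|$ for all $g\in G$). Let $Y=\Phi\cdot t_0+\sigma\epsilon$ with $\sigma>0$, $\Phi$ a random element of $G$ and $\epsilon$ a standardized noise in $M$ independent of $\Phi$. Put $$\theta(t_0)=\frac1{\|t_0\|}\mathbb{E}\Big(\sup_{g\in G}\langle g\cdot t_0,\epsilon\rangle\Big),\qquad \theta_H=\frac1{\|t_0\|}\mathbb{E}\Big(\sup_{h\in H}\langle h\cdot t_0,\epsilon\rangle\Big),$$ and suppose $\theta_H>0$. If $\sigma>\sigma_c$, where $$\sigma_c=\frac{\|t_0\|}{\theta_H}\left[\left(\frac{\theta(t_0)}{\theta_H}+A\right)+\sqrt{\left(\frac{\theta(t_0)}{\theta_H}+A\right)^2+A^2-a^2}\right],$$ then there is inconsistency: $t_0$ is not a minimizer over $M$ of the pre-variance $F(m)=\mathbb{E}\big(\inf_{g\in G}\|g\cdot m-Y\|^2\big)$.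
   Context: The action of $G$ on $M$ is not assumed to be isometric, linear, or to leave the distance invariant. The subgroup $H$ acts isometrically on $M$ if for each $h\in H$ the map $x\mapsto h\cdot x$ is linear and preserves the norm. A point $x$ is a fixed point under $G$ if $g\cdot x=x$ for all $g\in G$. A standardized noise is an $M$-valued random variable $\epsilon$ with $\mathbb{E}(\epsilon)=0$ and $\mathbb{E}(\|\epsilon\|^2)=1$. It is assumed that $\mathbb{E}(\|Y\|^2)<+\infty$. Estimation is consistent if $t_0$ minimizes $F$, and inconsistent otherwise. *)

theory Defs
  imports "HOL-Probability.Probability" "HOL-Algebra.Group_Action"
begin

definition acts_isometrically ::
    "('g \<Rightarrow> 'a::real_inner \<Rightarrow> 'a) \<Rightarrow> 'g set \<Rightarrow> bool" where
  "acts_isometrically act H \<longleftrightarrow>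
     (\<forall>h\<in>H. linear (act h) \<and> (\<forall>x. norm (act h x) = norm x))"

definition is_fixed_point ::
    "('g, 'c) monoid_scheme \<Rightarrow> ('g \<Rightarrow> 'a \<Rightarrow> 'a) \<Rightarrow> 'a \<Rightarrow> bool" where
  "is_fixed_point G act x \<longleftrightarrow> (\<forall>g\<in>carrier G. act g x = x)"

(* The library's Bochner integral is only available on second-countable types, whereas the
   Hilbert space here need not be separable.  The expectation of a vector-valued random
   variable is therefore the weak one, i.e. the vector representing the functional
   v \<mapsto> E <v, X>; where the Bochner integral exists the two agree (lemma below). *)
definition has_expectation :: "'w measure \<Rightarrow> ('w \<Rightarrow> 'a::real_inner) \<Rightarrow> 'a \<Rightarrow> bool" where
  "has_expectation P X m \<longleftrightarrow>
     (\<forall>v. integrable P (\<lambda>\<omega>. v \<bullet> X \<omega>) \<and> (\<integral>\<omega>. v \<bullet> X \<omega> \<partial>P) = v \<bullet> m)"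

lemma has_expectation_iff_integral:
  fixes X :: "'w \<Rightarrow> 'a::{real_inner, complete_space, second_countable_topology}"
  assumes "integrable P X"
  shows "has_expectation P X m \<longleftrightarrow> integral\<^sup>L P X = m"
proof -
  have "has_expectation P X m \<longleftrightarrow> (\<forall>v. v \<bullet> integral\<^sup>L P X = v \<bullet> m)"
    using assms by (simp add: has_expectation_def)
  also have "\<dots> \<longleftrightarrow> integral\<^sup>L P X = m"
    by (metis vector_eq_rdot inner_commute)
  finally show ?thesis .
qed

definition standardized_noise :: "'w measure \<Rightarrow> ('w \<Rightarrow> 'a::real_inner) \<Rightarrow> bool" where
  "standardized_noise P \<epsilon> \<longleftrightarrow>
     \<epsilon> \<in> borel_measurable P \<and> has_expectation P \<epsilon> 0 \<and>
     integrable P (\<lambda>\<omega>. (norm (\<epsilon> \<omega>))\<^sup>2) \<and> (\<integral>\<omega>. (norm (\<epsilon> \<omega>))\<^sup>2 \<partial>P) = 1"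

(* The library's indep_var forces both variables to take values in the same type, so
   independence is stated for the generated sigma-algebras. *)
definition independent_rvs ::
    "'w measure \<Rightarrow> 'b measure \<Rightarrow> ('w \<Rightarrow> 'b) \<Rightarrow> 'c measure \<Rightarrow> ('w \<Rightarrow> 'c) \<Rightarrow> bool" where
  "independent_rvs P S X T Z \<longleftrightarrow>
     X \<in> measurable P S \<and> Z \<in> measurable P T \<and>
     prob_space.indep_set P (sets (vimage_algebra (space P) X S))
                            (sets (vimage_algebra (space P) Z T))"

(* theta(t0) is the case K = carrier G, and theta_H the case K = H. *)
definition theta ::
    "'w measure \<Rightarrow> ('g \<Rightarrow> 'a::real_inner \<Rightarrow> 'a) \<Rightarrow> 'g set \<Rightarrow> 'a \<Rightarrow> ('w \<Rightarrow> 'a) \<Rightarrow> real" where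
  "theta P act K t0 \<epsilon> =
     1 / norm t0 * (\<integral>\<omega>. (SUP g\<in>K. act g t0 \<bullet> \<epsilon> \<omega>) \<partial>P)"

definition sigma_c :: "real \<Rightarrow> real \<Rightarrow> real \<Rightarrow> real \<Rightarrow> real \<Rightarrow> real" where
  "sigma_c r \<theta> \<theta>H A a =
     r / \<theta>H * ((\<theta> / \<theta>H + A) + sqrt ((\<theta> / \<theta>H + A)\<^sup>2 + A\<^sup>2 - a\<^sup>2))"

(* If Y is Borel measurable with E |Y|^2 < infinity, then the integrand is integrable for
   every m: it is the squared distance of Y to the orbit of m, at most |m - Y|^2. *)
definition pre_variance ::
    "'w measure \<Rightarrow> ('g, 'c) monoid_scheme \<Rightarrow> ('g \<Rightarrow> 'a::real_inner \<Rightarrow> 'a) \<Rightarrow> ('w \<Rightarrow> 'a)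
       \<Rightarrow> 'a \<Rightarrow> real" where
  "pre_variance P G act Y m =
     (\<integral>\<omega>. (INF g\<in>carrier G. (norm (act g m - Y \<omega>))\<^sup>2) \<partial>P)"

end

theory Submission
  imports Defs
begin

text \<open>
  Write \<open>r = \<parallel>t0\<parallel>\<close> and \<open>V = E \<parallel>Y\<parallel>\<^sup>2\<close>, and expand the squared norms in the pre-variance.
  At the template, each \<open>\<parallel>g t0 - Y\<parallel>\<^sup>2\<close> exceeds \<open>\<parallel>Y\<parallel>\<^sup>2\<close> by \<open>\<parallel>g t0\<parallel>\<^sup>2 - 2 \<langle>g t0, Y\<rangle>\<close>. Here
  \<open>\<parallel>g t0\<parallel> \<ge> a r\<close>, the signal part of \<open>\<langle>g t0, Y\<rangle>\<close> is at most \<open>A\<^sup>2 r\<^sup>2\<close> by Cauchy-Schwarz, and the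
  expected supremum of its noise part is \<open>\<sigma> r \<theta>\<close>. Hence
  \<open>F t0 \<ge> V + (a\<^sup>2 - 2 A\<^sup>2) r\<^sup>2 - 2 \<sigma> r \<theta>\<close> (lemma \<open>pre_variance_ge\<close>).

  The competitor is a dilation \<open>l t0\<close> with \<open>l > 0\<close>. Although \<open>G\<close> may move \<open>l t0\<close> in an
  uncontrolled way, restricting the infimum to \<open>H\<close> only increases it, and on \<open>H\<close> the action is
  linear and isometric: \<open>\<parallel>h (l t0) - Y\<parallel>\<^sup>2 = l\<^sup>2 r\<^sup>2 + \<parallel>Y\<parallel>\<^sup>2 - 2 l \<langle>h t0, Y\<rangle>\<close>. Aligning \<open>h t0\<close> with
  the noise gains \<open>\<sigma> r \<theta>\<^sub>H\<close> on average while the signal costs at most \<open>A r\<^sup>2\<close>, so that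
  \<open>F (l t0) \<le> V + l\<^sup>2 r\<^sup>2 - 2 l (\<sigma> r \<theta>\<^sub>H - A r\<^sup>2)\<close> (lemma \<open>pre_variance_dilation_le\<close>).

  The right-hand side is smallest at \<open>l = s - A\<close> with \<open>s = \<sigma> \<theta>\<^sub>H / r\<close>, with value
  \<open>V - (s - A)\<^sup>2 r\<^sup>2\<close>. It lies below the lower bound for \<open>F t0\<close> as soon as
  \<open>s\<^sup>2 - 2 (\<theta> / \<theta>\<^sub>H + A) s > A\<^sup>2 - a\<^sup>2\<close>. The threshold \<open>\<sigma>\<^sub>c\<close> is the value of \<open>\<sigma>\<close> at which \<open>s\<close> is
  the larger root of this quadratic inequality, so \<open>\<sigma> > \<sigma>\<^sub>c\<close> gives \<open>F (l t0) < F t0\<close>.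
\<close>

section \<open>Measurability and integrability of orbit suprema and infima\<close>

text \<open>
  The index set may be uncountable, so measurability cannot come from countable suprema. It comes
  from semicontinuity: a superlevel set of a supremum of continuous functions is a union of open
  sets.
\<close>

lemma borel_measurable_SUP_continuous:
  fixes f :: "'i \<Rightarrow> 'b::topological_space \<Rightarrow> real"
  assumes "I \<noteq> {}"
    and cont: "\<And>i. i \<in> I \<Longrightarrow> continuous_on UNIV (f i)"
    and bdd: "\<And>x. bdd_above ((\<lambda>i. f i x) ` I)"
  shows "(\<lambda>x. SUP i\<in>I. f i x) \<in> borel_measurable borel"
proof (rule borel_measurableI_greater)
  fix c :: real
  have "{x. c < (SUP i\<in>I. f i x)} = (\<Union>i\<in>I. {x. c < f i x})"
    using less_cSUP_iff[OF \<open>I \<noteq> {}\<close> bdd] by auto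
  moreover have "open {x. c < f i x}" if "i \<in> I" for i
    using cont[OF that] by (intro open_Collect_less continuous_intros)
  ultimately have "open {x. c < (SUP i\<in>I. f i x)}" by auto
  then show "{x \<in> space borel. c < (SUP i\<in>I. f i x)} \<in> sets borel"
    by (simp add: borel_open)
qed

lemma borel_measurable_INF_continuous:
  fixes f :: "'i \<Rightarrow> 'b::topological_space \<Rightarrow> real"
  assumes "I \<noteq> {}"
    and cont: "\<And>i. i \<in> I \<Longrightarrow> continuous_on UNIV (f i)"
    and bdd: "\<And>x. bdd_below ((\<lambda>i. f i x) ` I)"
  shows "(\<lambda>x. INF i\<in>I. f i x) \<in> borel_measurable borel"
proof (rule borel_measurableI_less)
  fix c :: real
  have "{x. (INF i\<in>I. f i x) < c} = (\<Union>i\<in>I. {x. f i x < c})"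
    using cINF_less_iff[OF \<open>I \<noteq> {}\<close> bdd] by auto
  moreover have "open {x. f i x < c}" if "i \<in> I" for i
    using cont[OF that] by (intro open_Collect_less continuous_intros)
  ultimately have "open {x. (INF i\<in>I. f i x) < c}" by auto
  then show "{x \<in> space borel. (INF i\<in>I. f i x) < c} \<in> sets borel"
    by (simp add: borel_open)
qed

lemma inner_le_norm_bound:
  fixes x y :: "'a::real_inner"
  assumes "norm x \<le> B"
  shows "\<bar>x \<bullet> y\<bar> \<le> B * norm y"
  using Cauchy_Schwarz_ineq2[of x y] mult_right_mono[OF assms norm_ge_zero[of y]] by linarith

lemma bdd_above_inner_image:
  fixes f :: "'i \<Rightarrow> 'a::real_inner"
  assumes "\<And>i. i \<in> I \<Longrightarrow> norm (f i) \<le> B"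
  shows "bdd_above ((\<lambda>i. f i \<bullet> x) ` I)"
  using inner_le_norm_bound[OF assms, of _ x]
  by (intro bdd_aboveI2[where M = "B * norm x"]) (auto dest: abs_le_D1)

lemma bdd_below_squared_distances:
  fixes f :: "'i \<Rightarrow> 'a::real_normed_vector"
  shows "bdd_below ((\<lambda>i. (norm (f i - y))\<^sup>2) ` I)"
  by (intro bdd_belowI2[where m = 0]) simp

lemma integrable_SUP_inner:
  fixes f :: "'i \<Rightarrow> 'a::real_inner"
  assumes "prob_space P" and meas: "X \<in> borel_measurable P"
    and sq: "integrable P (\<lambda>\<omega>. (norm (X \<omega>))\<^sup>2)"
    and ne: "I \<noteq> {}" and bound: "\<And>i. i \<in> I \<Longrightarrow> norm (f i) \<le> B"
  shows "integrable P (\<lambda>\<omega>. SUP i\<in>I. f i \<bullet> X \<omega>)"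
proof -
  interpret prob_space P by fact
  obtain j where j: "j \<in> I" using ne by blast
  have B: "0 \<le> B" using bound[OF j] norm_ge_zero order_trans by blast
  have bdd: "bdd_above ((\<lambda>i. f i \<bullet> x) ` I)" for x
    using bound by (rule bdd_above_inner_image)
  have "(\<lambda>x. SUP i\<in>I. f i \<bullet> x) \<in> borel_measurable borel"
    by (rule borel_measurable_SUP_continuous[OF ne _ bdd]) (intro continuous_intros)
  then have m: "(\<lambda>\<omega>. SUP i\<in>I. f i \<bullet> X \<omega>) \<in> borel_measurable P"
    using meas by (rule measurable_compose[rotated])
  have abs_le: "\<bar>SUP i\<in>I. f i \<bullet> x\<bar> \<le> B * (1 + (norm x)\<^sup>2)" for x
  proof -
    have "(SUP i\<in>I. f i \<bullet> x) \<le> B * norm x"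
      using inner_le_norm_bound[OF bound] ne by (intro cSUP_least) (auto dest: abs_le_D1)
    moreover have "f j \<bullet> x \<le> (SUP i\<in>I. f i \<bullet> x)"
      by (intro cSUP_upper j bdd)
    ultimately have "\<bar>SUP i\<in>I. f i \<bullet> x\<bar> \<le> B * norm x"
      using inner_le_norm_bound[OF bound[OF j], of x] by linarith
    \<comment> \<open>On a probability space the second moment controls the first.\<close>
    also have "norm x \<le> 1 + (norm x)\<^sup>2"
      using zero_le_power2[of "norm x - 1/2"] by (simp add: power2_diff power_divide)
    then have "B * norm x \<le> B * (1 + (norm x)\<^sup>2)" using B by (rule mult_left_mono)
    finally show ?thesis .
  qed
  show ?thesis
  proof (rule Bochner_Integration.integrable_bound[OF _ m])
    show "integrable P (\<lambda>\<omega>. B * (1 + (norm (X \<omega>))\<^sup>2))" using sq by simp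
    show "AE \<omega> in P. norm (SUP i\<in>I. f i \<bullet> X \<omega>) \<le> norm (B * (1 + (norm (X \<omega>))\<^sup>2))"
      using order_trans[OF abs_le abs_ge_self] by (intro AE_I2) simp
  qed
qed

lemma integrable_INF_squared_distance:
  fixes f :: "'i \<Rightarrow> 'a::real_inner"
  assumes "prob_space P" and meas: "Y \<in> borel_measurable P"
    and sq: "integrable P (\<lambda>\<omega>. (norm (Y \<omega>))\<^sup>2)"
    and ne: "I \<noteq> {}"
  shows "integrable P (\<lambda>\<omega>. INF i\<in>I. (norm (f i - Y \<omega>))\<^sup>2)"
proof -
  interpret prob_space P by fact
  obtain j where j: "j \<in> I" using ne by blast
  have "(\<lambda>y. INF i\<in>I. (norm (f i - y))\<^sup>2) \<in> borel_measurable borel"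
    by (rule borel_measurable_INF_continuous[OF ne _ bdd_below_squared_distances])
       (intro continuous_intros)
  then have m: "(\<lambda>\<omega>. INF i\<in>I. (norm (f i - Y \<omega>))\<^sup>2) \<in> borel_measurable P"
    using meas by (rule measurable_compose[rotated])
  have abs_le: "\<bar>INF i\<in>I. (norm (f i - y))\<^sup>2\<bar> \<le> 2 * (norm (f j))\<^sup>2 + 2 * (norm y)\<^sup>2" for y
  proof -
    have "0 \<le> (INF i\<in>I. (norm (f i - y))\<^sup>2)" using ne by (intro cINF_greatest) auto
    moreover have "(INF i\<in>I. (norm (f i - y))\<^sup>2) \<le> (norm (f j - y))\<^sup>2"
      by (intro cINF_lower j bdd_below_squared_distances)
    \<comment> \<open>The parallelogram law replaces the triangle inequality.\<close>
    moreover have "(norm (f j - y))\<^sup>2 + (norm (f j + y))\<^sup>2 = 2 * (norm (f j))\<^sup>2 + 2 * (norm y)\<^sup>2"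
      by (simp add: power2_norm_eq_inner algebra_simps inner_commute)
    ultimately show ?thesis using zero_le_power2[of "norm (f j + y)"] by linarith
  qed
  show ?thesis
  proof (rule Bochner_Integration.integrable_bound[OF _ m])
    show "integrable P (\<lambda>\<omega>. 2 * (norm (f j))\<^sup>2 + 2 * (norm (Y \<omega>))\<^sup>2)" using sq by simp
    show "AE \<omega> in P. norm (INF i\<in>I. (norm (f i - Y \<omega>))\<^sup>2)
        \<le> norm (2 * (norm (f j))\<^sup>2 + 2 * (norm (Y \<omega>))\<^sup>2)"
      using order_trans[OF abs_le abs_ge_self] by (intro AE_I2) simp
  qed
qed

section \<open>Two bounds for the pre-variance\<close>

lemma integral_SUP_inner_eq_theta:
  assumes "t0 \<noteq> 0"
  shows "(\<integral>\<omega>. (SUP g\<in>K. act g t0 \<bullet> \<epsilon> \<omega>) \<partial>P) = norm t0 * theta P act K t0 \<epsilon>"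
  using assms by (simp add: theta_def)

text \<open>
  The supremum over the group only enters through a single estimate of \<open>\<langle>g t0, Y\<rangle>\<close> that holds for
  all \<open>g\<close> at once, so a pointwise bound can be integrated. The signal \<open>X\<close> stands for the random
  orbit point \<open>\<Phi> t0\<close>.
\<close>

lemma pre_variance_ge:
  fixes act :: "'g \<Rightarrow> 'a::real_inner \<Rightarrow> 'a"
  assumes P: "prob_space P" and ne: "carrier G \<noteq> {}" and t0: "t0 \<noteq> 0"
    and lower: "\<And>g. g \<in> carrier G \<Longrightarrow> b \<le> norm (act g t0)" and b: "0 \<le> b"
    and upper: "\<And>g. g \<in> carrier G \<Longrightarrow> norm (act g t0) \<le> B"
    and X: "\<And>\<omega>. \<omega> \<in> space P \<Longrightarrow> norm (X \<omega>) \<le> B"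
    and Y: "\<And>\<omega>. Y \<omega> = X \<omega> + \<sigma> *\<^sub>R \<epsilon> \<omega>" and \<sigma>: "0 \<le> \<sigma>"
    and Y_meas: "Y \<in> borel_measurable P" and Y_sq: "integrable P (\<lambda>\<omega>. (norm (Y \<omega>))\<^sup>2)"
    and e_meas: "\<epsilon> \<in> borel_measurable P" and e_sq: "integrable P (\<lambda>\<omega>. (norm (\<epsilon> \<omega>))\<^sup>2)"
  shows "(\<integral>\<omega>. (norm (Y \<omega>))\<^sup>2 \<partial>P) + b\<^sup>2 - 2 * B\<^sup>2
           - 2 * \<sigma> * (norm t0 * theta P act (carrier G) t0 \<epsilon>)
         \<le> pre_variance P G act Y t0"
proof -
  interpret prob_space P by fact
  let ?S = "\<lambda>\<omega>. SUP g\<in>carrier G. act g t0 \<bullet> \<epsilon> \<omega>"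
  let ?D = "\<lambda>\<omega>. INF g\<in>carrier G. (norm (act g t0 - Y \<omega>))\<^sup>2"
  have S_int: "integrable P ?S" by (rule integrable_SUP_inner[OF P e_meas e_sq ne upper])
  have D_int: "integrable P ?D" by (rule integrable_INF_squared_distance[OF P Y_meas Y_sq ne])
  have bdd: "bdd_above ((\<lambda>g. act g t0 \<bullet> x) ` carrier G)" for x
    using upper by (rule bdd_above_inner_image)
  have pointwise: "(norm (Y \<omega>))\<^sup>2 + (b\<^sup>2 - 2 * B\<^sup>2) - 2 * \<sigma> * ?S \<omega> \<le> ?D \<omega>"
    if \<omega>: "\<omega> \<in> space P" for \<omega>
  proof (rule cINF_greatest[OF ne])
    fix g assume g: "g \<in> carrier G"
    have "b\<^sup>2 \<le> (norm (act g t0))\<^sup>2" using lower[OF g] b by (rule power_mono)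
    moreover have "act g t0 \<bullet> X \<omega> \<le> B\<^sup>2"
    proof -
      have "0 \<le> B" using X[OF \<omega>] norm_ge_zero order_trans by blast
      then have "B * norm (X \<omega>) \<le> B * B" using X[OF \<omega>] by (intro mult_left_mono)
      then show ?thesis
        using inner_le_norm_bound[OF upper[OF g], of "X \<omega>"] by (simp add: power2_eq_square)
    qed
    moreover have "\<sigma> * (act g t0 \<bullet> \<epsilon> \<omega>) \<le> \<sigma> * ?S \<omega>"
      using \<sigma> by (intro mult_left_mono cSUP_upper g bdd)
    moreover have "(norm (act g t0 - Y \<omega>))\<^sup>2
        = (norm (act g t0))\<^sup>2 + (norm (Y \<omega>))\<^sup>2
          - 2 * (act g t0 \<bullet> X \<omega>) - 2 * (\<sigma> * (act g t0 \<bullet> \<epsilon> \<omega>))"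
    proof -
      have "(norm (act g t0 - Y \<omega>))\<^sup>2
          = (norm (act g t0))\<^sup>2 + (norm (Y \<omega>))\<^sup>2 - 2 * (act g t0 \<bullet> Y \<omega>)"
        by (simp add: power2_norm_eq_inner algebra_simps inner_commute)
      then show ?thesis by (simp add: Y inner_add_right)
    qed
    ultimately show "(norm (Y \<omega>))\<^sup>2 + (b\<^sup>2 - 2 * B\<^sup>2) - 2 * \<sigma> * ?S \<omega>
        \<le> (norm (act g t0 - Y \<omega>))\<^sup>2"
      by linarith
  qed
  have "(\<integral>\<omega>. ((norm (Y \<omega>))\<^sup>2 + (b\<^sup>2 - 2 * B\<^sup>2) - 2 * \<sigma> * ?S \<omega>) \<partial>P) \<le> (\<integral>\<omega>. ?D \<omega> \<partial>P)"
    using Y_sq S_int D_int pointwise by (intro integral_mono) auto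
  then show ?thesis
    using Y_sq S_int integral_SUP_inner_eq_theta[OF t0, of P act \<epsilon> "carrier G"]
    by (simp add: pre_variance_def prob_space)
qed

text \<open>
  Isometry and linearity of \<open>H\<close> are what make the orbit of the dilated template computable: on \<open>H\<close>
  the dilation factors out. Restricting the infimum to \<open>H\<close> costs nothing for an upper bound.
\<close>

lemma pre_variance_dilation_le:
  fixes act :: "'g \<Rightarrow> 'a::real_inner \<Rightarrow> 'a"
  assumes P: "prob_space P" and ne: "H \<noteq> {}" and H: "H \<subseteq> carrier G" and t0: "t0 \<noteq> 0"
    and iso: "acts_isometrically act H"
    and X: "\<And>\<omega>. \<omega> \<in> space P \<Longrightarrow> norm (X \<omega>) \<le> B"
    and Y: "\<And>\<omega>. Y \<omega> = X \<omega> + \<sigma> *\<^sub>R \<epsilon> \<omega>" and \<sigma>: "0 < \<sigma>" and l: "0 < l"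
    and Y_meas: "Y \<in> borel_measurable P" and Y_sq: "integrable P (\<lambda>\<omega>. (norm (Y \<omega>))\<^sup>2)"
    and e_meas: "\<epsilon> \<in> borel_measurable P" and e_sq: "integrable P (\<lambda>\<omega>. (norm (\<epsilon> \<omega>))\<^sup>2)"
  shows "pre_variance P G act Y (l *\<^sub>R t0)
         \<le> (\<integral>\<omega>. (norm (Y \<omega>))\<^sup>2 \<partial>P) + l\<^sup>2 * (norm t0)\<^sup>2 + 2 * l * norm t0 * B
           - 2 * l * \<sigma> * (norm t0 * theta P act H t0 \<epsilon>)"
proof -
  interpret prob_space P by fact
  let ?S = "\<lambda>\<omega>. SUP h\<in>H. act h t0 \<bullet> \<epsilon> \<omega>"
  let ?D = "\<lambda>\<omega>. INF g\<in>carrier G. (norm (act g (l *\<^sub>R t0) - Y \<omega>))\<^sup>2"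
  let ?U = "\<lambda>\<omega>. (norm (Y \<omega>))\<^sup>2 + (l\<^sup>2 * (norm t0)\<^sup>2 + 2 * l * norm t0 * B)"
  have norm_H: "norm (act h t0) = norm t0" if "h \<in> H" for h
    using iso that by (simp add: acts_isometrically_def)
  have S_int: "integrable P ?S"
    by (rule integrable_SUP_inner[OF P e_meas e_sq ne, where B = "norm t0"]) (simp add: norm_H)
  have D_int: "integrable P ?D"
    using ne H by (intro integrable_INF_squared_distance[OF P Y_meas Y_sq]) auto
  have pointwise: "?D \<omega> \<le> ?U \<omega> - 2 * l * \<sigma> * ?S \<omega>" if \<omega>: "\<omega> \<in> space P" for \<omega>
  proof -
    have "act h t0 \<bullet> \<epsilon> \<omega> \<le> (?U \<omega> - ?D \<omega>) / (2 * l * \<sigma>)" if h: "h \<in> H" for h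
    proof -
      have "linear (act h)" using iso h by (simp add: acts_isometrically_def)
      then have scale: "act h (l *\<^sub>R t0) = l *\<^sub>R act h t0" by (rule linear_scale)
      have "?D \<omega> \<le> (norm (act h (l *\<^sub>R t0) - Y \<omega>))\<^sup>2"
        using h H by (intro cINF_lower bdd_below_squared_distances) auto
      also have "\<dots> = l\<^sup>2 * (norm (act h t0))\<^sup>2 + (norm (Y \<omega>))\<^sup>2 - 2 * l * (act h t0 \<bullet> Y \<omega>)"
        unfolding scale power2_norm_eq_inner
        by (simp add: algebra_simps inner_commute power2_eq_square)
      also have "\<dots> = l\<^sup>2 * (norm t0)\<^sup>2 + (norm (Y \<omega>))\<^sup>2 - 2 * l * (act h t0 \<bullet> X \<omega>)
          - 2 * l * \<sigma> * (act h t0 \<bullet> \<epsilon> \<omega>)"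
        by (simp add: norm_H[OF h] Y inner_add_right algebra_simps)
      finally have D: "?D \<omega> \<le> \<dots>" .
      have "norm t0 * norm (X \<omega>) \<le> norm t0 * B"
        using X[OF \<omega>] by (intro mult_left_mono) auto
      then have "- (act h t0 \<bullet> X \<omega>) \<le> norm t0 * B"
        using inner_le_norm_bound[of "act h t0" "norm t0" "X \<omega>"] norm_H[OF h] by linarith
      then have "2 * l * - (act h t0 \<bullet> X \<omega>) \<le> 2 * l * (norm t0 * B)"
        using l by (intro mult_left_mono) auto
      then have "- (2 * l * (act h t0 \<bullet> X \<omega>)) \<le> 2 * l * norm t0 * B"
        by (simp only: mult_minus_right mult.assoc)
      then have "2 * l * \<sigma> * (act h t0 \<bullet> \<epsilon> \<omega>) \<le> ?U \<omega> - ?D \<omega>"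
        using D by linarith
      then show ?thesis using l \<sigma> by (simp add: pos_le_divide_eq mult.commute)
    qed
    then have "?S \<omega> \<le> (?U \<omega> - ?D \<omega>) / (2 * l * \<sigma>)" using ne by (intro cSUP_least)
    then have "?S \<omega> * (2 * l * \<sigma>) \<le> ?U \<omega> - ?D \<omega>" using l \<sigma> by (simp add: pos_le_divide_eq)
    then show ?thesis by (simp add: mult.commute)
  qed
  have "(\<integral>\<omega>. ?D \<omega> \<partial>P) \<le> (\<integral>\<omega>. (?U \<omega> - 2 * l * \<sigma> * ?S \<omega>) \<partial>P)"
    using Y_sq S_int D_int pointwise by (intro integral_mono) auto
  then show ?thesis
    using Y_sq S_int integral_SUP_inner_eq_theta[OF t0, of P act \<epsilon> H]
    by (simp add: pre_variance_def prob_space)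
qed

section \<open>The noise threshold\<close>

lemma above_larger_root_imp_quadratic_gt:
  fixes s c d :: real
  assumes "c + sqrt (c\<^sup>2 + d) < s" and "0 \<le> c\<^sup>2 + d"
  shows "d < s\<^sup>2 - 2 * c * s"
proof -
  have "(sqrt (c\<^sup>2 + d))\<^sup>2 < (s - c)\<^sup>2" using assms by (intro power_strict_mono) auto
  then show ?thesis using assms(2) by (simp add: power2_diff algebra_simps)
qed

theorem proposition3p4:
  fixes G :: "('g, 'c) monoid_scheme"
    and act :: "'g \<Rightarrow> 'a::{real_inner, complete_space} \<Rightarrow> 'a"
    and H :: "'g set"
    and t0 :: 'a
    and A a \<sigma> :: real
    and P :: "'w measure"
    and S :: "'g measure"
    and \<Phi> :: "'w \<Rightarrow> 'g"
    and \<epsilon> Y :: "'w \<Rightarrow> 'a"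
  assumes action: "group_action G (UNIV :: 'a set) act"
    and subgroup: "subgroup H G"
    and isometric: "acts_isometrically act H"
    and t0_nz: "t0 \<noteq> 0"
    and t0_not_fixed: "\<not> is_fixed_point G act t0"
    and orbit_bounded: "bounded (orbit G act t0)"
    and A_ge: "A \<ge> (SUP g\<in>carrier G. norm (act g t0) / norm t0)"
    and a_nonneg: "0 \<le> a"
    and a_le: "a \<le> (INF g\<in>carrier G. norm (act g t0) / norm t0)"
    and prob: "prob_space P"
    and G_space: "space S = carrier G"
    and orbit_map_measurable: "(\<lambda>g. act g t0) \<in> borel_measurable S"
    and noise: "standardized_noise P \<epsilon>"
    and indep: "independent_rvs P S \<Phi> borel \<epsilon>"
    and \<sigma>_pos: "\<sigma> > 0"
    and Y_eq: "Y = (\<lambda>\<omega>. act (\<Phi> \<omega>) t0 + \<sigma> *\<^sub>R \<epsilon> \<omega>)"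
    and Y_measurable: "Y \<in> borel_measurable P"
    and Y_square_integrable: "integrable P (\<lambda>\<omega>. (norm (Y \<omega>))\<^sup>2)"
    and \<theta>H_pos: "theta P act H t0 \<epsilon> > 0"
    and \<sigma>_large: "\<sigma> > sigma_c (norm t0) (theta P act (carrier G) t0 \<epsilon>)
                          (theta P act H t0 \<epsilon>) A a"
  shows "\<not> (\<forall>m. pre_variance P G act Y t0 \<le> pre_variance P G act Y m)"
proof -
  interpret group_action G "UNIV :: 'a set" act by (rule action)
  interpret prob_space P by (rule prob)
  let ?r = "norm t0" and ?\<theta> = "theta P act (carrier G) t0 \<epsilon>" and ?\<theta>H = "theta P act H t0 \<epsilon>"
  let ?V = "\<integral>\<omega>. (norm (Y \<omega>))\<^sup>2 \<partial>P"
  have r: "0 < ?r" using t0_nz by simp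
  have one: "\<one>\<^bsub>G\<^esub> \<in> carrier G" using group_hom.axioms(1)[OF group_hom] by (simp add: group.is_monoid)
  then have G_ne: "carrier G \<noteq> {}" by blast
  have H: "H \<subseteq> carrier G" and H_ne: "H \<noteq> {}"
    using subgroup subgroup.subset subgroup.one_closed by blast+

  obtain C where C: "\<And>g. g \<in> carrier G \<Longrightarrow> norm (act g t0) \<le> C"
    using orbit_bounded unfolding bounded_iff orbit_def by blast
  have ratio_above: "bdd_above ((\<lambda>g. norm (act g t0) / ?r) ` carrier G)"
    using C r by (intro bdd_aboveI2[where M = "C / ?r"]) (simp add: divide_right_mono)
  have ratio_below: "bdd_below ((\<lambda>g. norm (act g t0) / ?r) ` carrier G)"
    by (intro bdd_belowI2[where m = 0]) simp
  have ratio_le: "norm (act g t0) / ?r \<le> A" if "g \<in> carrier G" for g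
    using cSUP_upper[OF that ratio_above] A_ge by linarith
  have ratio_ge: "a \<le> norm (act g t0) / ?r" if "g \<in> carrier G" for g
    using cINF_lower[OF ratio_below that] a_le by linarith
  have upper: "norm (act g t0) \<le> A * ?r" if "g \<in> carrier G" for g
    using ratio_le[OF that] r by (simp add: pos_divide_le_eq)
  have lower: "a * ?r \<le> norm (act g t0)" if "g \<in> carrier G" for g
    using ratio_ge[OF that] r by (simp add: pos_le_divide_eq)
  have "a \<le> A" using ratio_le[OF one] ratio_ge[OF one] by linarith
  then have d: "0 \<le> A\<^sup>2 - a\<^sup>2" using a_nonneg by (simp add: power_mono)

  have e_meas: "\<epsilon> \<in> borel_measurable P" and e_sq: "integrable P (\<lambda>\<omega>. (norm (\<epsilon> \<omega>))\<^sup>2)"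
    using noise by (auto simp: standardized_noise_def)
  have "\<Phi> \<in> measurable P S" using indep by (simp add: independent_rvs_def)
  then have X: "norm (act (\<Phi> \<omega>) t0) \<le> A * ?r" if "\<omega> \<in> space P" for \<omega>
    using that measurable_space G_space upper by metis

  \<comment> \<open>Positivity of \<open>\<theta>\<close>, inherited from \<open>\<theta>\<^sub>H\<close>, puts the threshold for \<open>s\<close> above \<open>A\<close>, so that
    the dilation factor \<open>s - A\<close> below is positive.\<close>
  have "?r * ?\<theta>H \<le> ?r * ?\<theta>"
    unfolding integral_SUP_inner_eq_theta[OF t0_nz, symmetric]
  proof (rule integral_mono)
    show "integrable P (\<lambda>\<omega>. SUP h\<in>H. act h t0 \<bullet> \<epsilon> \<omega>)"
      using H upper by (intro integrable_SUP_inner[OF prob e_meas e_sq H_ne]) auto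
    show "integrable P (\<lambda>\<omega>. SUP g\<in>carrier G. act g t0 \<bullet> \<epsilon> \<omega>)"
      by (rule integrable_SUP_inner[OF prob e_meas e_sq G_ne upper])
    show "(SUP h\<in>H. act h t0 \<bullet> \<epsilon> \<omega>) \<le> (SUP g\<in>carrier G. act g t0 \<bullet> \<epsilon> \<omega>)" for \<omega>
      using H by (intro cSUP_subset_mono H_ne bdd_above_inner_image[where B = "A * ?r"])
        (auto simp: upper)
  qed
  then have \<theta>: "0 < ?\<theta>" using r \<theta>H_pos by simp

  define q where "q = ?\<theta> / ?\<theta>H"
  define s where "s = \<sigma> * ?\<theta>H / ?r"
  have q: "0 < q" using \<theta> \<theta>H_pos by (simp add: q_def)
  have s_gt: "(q + A) + sqrt ((q + A)\<^sup>2 + (A\<^sup>2 - a\<^sup>2)) < s"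
    using \<sigma>_large r \<theta>H_pos unfolding sigma_c_def q_def[symmetric] s_def
    by (simp add: field_simps)
  have s_quadratic: "A\<^sup>2 - a\<^sup>2 < s\<^sup>2 - 2 * (q + A) * s"
    by (rule above_larger_root_imp_quadratic_gt[OF s_gt]) (use d in simp)
  have "0 \<le> sqrt ((q + A)\<^sup>2 + (A\<^sup>2 - a\<^sup>2))" using d by simp
  then have l: "0 < s - A" using s_gt q by linarith
  have noise_H: "\<sigma> * (?r * ?\<theta>H) = s * ?r\<^sup>2" using r by (simp add: s_def power2_eq_square)
  have noise_G: "\<sigma> * (?r * ?\<theta>) = q * s * ?r\<^sup>2"
    using r \<theta>H_pos by (simp add: s_def q_def power2_eq_square)

  \<comment> \<open>The dilation factor \<open>s - A\<close> minimises the quadratic upper bound in the dilation.\<close>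
  have "pre_variance P G act Y ((s - A) *\<^sub>R t0)
      \<le> ?V + (s - A)\<^sup>2 * ?r\<^sup>2 + 2 * (s - A) * ?r * (A * ?r) - 2 * (s - A) * \<sigma> * (?r * ?\<theta>H)"
    by (rule pre_variance_dilation_le[where B = "A * ?r"
          and X = "\<lambda>\<omega>. act (\<Phi> \<omega>) t0", OF prob H_ne H t0_nz isometric X _ \<sigma>_pos l
          Y_measurable Y_square_integrable e_meas e_sq]) (simp_all add: Y_eq)
  also have "\<dots> = ?V - (s - A)\<^sup>2 * ?r\<^sup>2"
    unfolding mult.assoc[of _ \<sigma>] noise_H by (simp add: power2_eq_square algebra_simps)
  also have "\<dots> < ?V + (a * ?r)\<^sup>2 - 2 * (A * ?r)\<^sup>2 - 2 * \<sigma> * (?r * ?\<theta>)"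
  proof -
    have "0 < (s\<^sup>2 - 2 * (q + A) * s - (A\<^sup>2 - a\<^sup>2)) * ?r\<^sup>2" using s_quadratic r by simp
    then show ?thesis
      unfolding mult.assoc[of _ \<sigma>] noise_G by (simp add: power2_eq_square algebra_simps)
  qed
  also have "\<dots> \<le> pre_variance P G act Y t0"
    by (rule pre_variance_ge[where act = act and b = "a * ?r" and B = "A * ?r"
          and X = "\<lambda>\<omega>. act (\<Phi> \<omega>) t0", OF prob G_ne t0_nz lower _ upper X _ _
          Y_measurable Y_square_integrable e_meas e_sq])
       (use a_nonneg \<sigma>_pos in \<open>simp_all add: Y_eq\<close>)
  finally show ?thesis by (auto simp: not_le)
qed

end
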